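(* Let $d\ge 1$ and let $\lambda=(\lambda_1,\dots,\lambda_d)$ be a composition of a positive integer $n$. For $s>0$ let $Z_d(\lambda)\subset\mathbb R^{d+1}$ be the zonotope (Minkowski sum of segments) \[ Z_d(\lambda)=\left[0, s\,e_{d+1}\right] + \sum_{1 \leq i < j \leq d} \sum_{k=0}^{\lambda_i - 1} \sum_{l=0}^{\lambda_j - 1} \left[ 0, e_j - e_i + (2l-2k)\, e_{d+1} \right], \] where $e_1,\dots,e_{d+1}$ are the unit coordinate vectors of $\mathbb R^{d+1}$. Then, for $s$ sufficiently large, the polytope $\Pi_d(\lambda)$ is an upper truncation of a translate of $\frac1n Z_d(\lambda)$, cut by the hyperplane $\lambda_1x_1+\lambda_2x_2+\cdots+\lambda_dx_d=x_{d+1}$.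
   Context: Here $\lambda$ being a composition of $n$ means the $\lambda_i$ are positive integers with $\lambda_1+\cdots+\lambda_d=n$. Let $B(\lambda)=\{x\in\mathbb R^d: 0\le x_i\le \lambda_i \text{ for all } i\}$ and $f(x)=x_1^2+\cdots+x_d^2$. The lifted pile of cubes is the polytope $\widetilde{\mathcal P}_{d+1}(\lambda)=\mathrm{conv}\{(x,f(x)) : x\in B(\lambda)\cap\mathbb Z^d\}\subset\mathbb R^{d+1}$. Let $\pi:\mathbb R^{d+1}\to\mathbb R$, $\pi(x)=x_1+\cdots+x_d$, which maps $\widetilde{\mathcal P}_{d+1}(\lambda)$ onto $[0,n]$. The monotone path polytope $\Pi_d(\lambda)$ is the fiber polytope of this projection: the set of all points $\frac1n\int_0^n\gamma(t)\,dt$, where $\gamma:[0,n]\to\widetilde{\mathcal P}_{d+1}(\lambda)$ ranges over all continuous maps with $\pi(\gamma(t))=t$ for all $t$. A face $F$ of a polytope $P\subset\mathbb R^{d+1}$ is a lower (resp. upper) face if $F$ is the set of maximizers on $P$ of some linear functional whose $(d+1)$st coefficient is negative (resp. positive); the lower (resp. upper) part of $P$ is the union of its lower (resp. upper) faces. A truncation of a polytope $P\subset\mathbb R^{d+1}$ is its intersection with a closed halfspace $\{x: a\cdot x\le 0\}$, $a\in\mathbb R^{d+1}$; it is an upper truncation if it contains the lower part of $P$ and the upper part of $P$ does not meet the open region $\{a\cdot x<0\}$. *)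

theory Defs
  imports "HOL-Analysis.Analysis" "HOL-Library.Set_Algebras"
begin

text \<open>
  The coordinates \<open>1, \<dots>, d\<close> are the elements, in increasing order, of a finite linearly
  ordered type \<open>'d\<close> with \<open>d = CARD('d)\<close>; up to renaming of indices this is an arbitrary
  \<open>d \<ge> 1\<close>. The space \<open>\<real>\<^sup>d\<^sup>+\<^sup>1\<close> is \<open>(real ^ 'd) \<times> real\<close>, whose second component is the coordinate
  number \<open>d + 1\<close>.
\<close>

subsection \<open>Compositions and the lifted pile of cubes\<close>

definition composition_of :: "nat \<Rightarrow> ('d::finite \<Rightarrow> nat) \<Rightarrow> bool" where
  "composition_of n lam \<longleftrightarrow> (\<forall>i. 0 < lam i) \<and> (\<Sum>i\<in>UNIV. lam i) = n"

definition box_of :: "('d::finite \<Rightarrow> nat) \<Rightarrow> (real ^ 'd) set" where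
  "box_of lam = {x. \<forall>i. 0 \<le> x $ i \<and> x $ i \<le> real (lam i)}"

definition integer_points :: "(real ^ 'd) set" where
  "integer_points = {x. \<forall>i. x $ i \<in> \<int>}"

definition sum_of_squares :: "(real ^ 'd) \<Rightarrow> real" where
  "sum_of_squares x = (\<Sum>i\<in>UNIV. (x $ i)\<^sup>2)"

definition lifted_pile_of_cubes :: "('d::finite \<Rightarrow> nat) \<Rightarrow> ((real ^ 'd) \<times> real) set" where
  "lifted_pile_of_cubes lam =
     convex hull ((\<lambda>x. (x, sum_of_squares x)) ` (box_of lam \<inter> integer_points))"

subsection \<open>The monotone path polytope\<close>

definition coord_sum :: "(real ^ 'd) \<times> real \<Rightarrow> real" where
  "coord_sum p = (\<Sum>i\<in>UNIV. fst p $ i)"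

definition monotone_path_polytope :: "('d::finite \<Rightarrow> nat) \<Rightarrow> ((real ^ 'd) \<times> real) set" where
  "monotone_path_polytope lam =
     (let n = real (\<Sum>i\<in>UNIV. lam i) in
      {(1 / n) *\<^sub>R integral {0..n} \<gamma> | \<gamma>.
         continuous_on {0..n} \<gamma> \<and>
         (\<forall>t\<in>{0..n}. \<gamma> t \<in> lifted_pile_of_cubes lam \<and> coord_sum (\<gamma> t) = t)})"

subsection \<open>The zonotope\<close>

definition unit_vec :: "'d::finite \<Rightarrow> (real ^ 'd) \<times> real" where
  "unit_vec i = (axis i 1, 0)"

definition last_unit_vec :: "(real ^ 'd) \<times> real" where
  "last_unit_vec = (0, 1)"

text \<open>Sums of sets, here and in \<open>\<Sum>\<close>, are Minkowski sums.\<close>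

definition zonotope_Z :: "('d::{finite,linorder} \<Rightarrow> nat) \<Rightarrow> real \<Rightarrow> ((real ^ 'd::{finite,linorder}) \<times> real) set" where
  "zonotope_Z lam s =
     closed_segment 0 (s *\<^sub>R last_unit_vec) +
     (\<Sum>(i, j)\<in>{(i, j). i < j}. \<Sum>k<lam i. \<Sum>l<lam j.
        closed_segment 0
          (unit_vec j - unit_vec i + (2 * real l - 2 * real k) *\<^sub>R last_unit_vec))"

subsection \<open>Lower and upper parts, truncations\<close>

definition maximizers :: "'a::real_inner \<Rightarrow> 'a set \<Rightarrow> 'a set" where
  "maximizers c P = {x \<in> P. \<forall>y\<in>P. c \<bullet> y \<le> c \<bullet> x}"

definition lower_part :: "((real ^ 'd) \<times> real) set \<Rightarrow> ((real ^ 'd) \<times> real) set" where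
  "lower_part P = \<Union> {F. \<exists>c. snd c < 0 \<and> F = maximizers c P}"

definition upper_part :: "((real ^ 'd) \<times> real) set \<Rightarrow> ((real ^ 'd) \<times> real) set" where
  "upper_part P = \<Union> {F. \<exists>c. snd c > 0 \<and> F = maximizers c P}"

text \<open>\<open>Q\<close> is an upper truncation of \<open>P\<close> whose cutting hyperplane is \<open>H\<close>.\<close>

definition upper_truncation ::
    "((real ^ 'd) \<times> real) set \<Rightarrow> ((real ^ 'd) \<times> real) set \<Rightarrow> ((real ^ 'd) \<times> real) set \<Rightarrow> bool" where
  "upper_truncation Q P H \<longleftrightarrow>
     (\<exists>a. H = {x. a \<bullet> x = 0} \<and>
          Q = P \<inter> {x. a \<bullet> x \<le> 0} \<and>
          lower_part P \<subseteq> Q \<and>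
          upper_part P \<inter> {x. a \<bullet> x < 0} = {})"

end

theory Submission
  imports Defs
begin

text \<open>
  Up to adding the vertical ray, the pile of cubes is a Minkowski sum of the segments \<open>[0, w]\<close> where
  \<open>w\<close> runs over the \<open>n\<close> vectors \<open>e\<^sub>i + (2k + 1) e\<^sub>d\<^sub>+\<^sub>1\<close>, \<open>k < \<lambda>\<^sub>i\<close>. For a linear functional with
  nonnegative last coefficient, the path that traverses these vectors in increasing order of the
  functional minimizes it on every slice of the pile, and the integral of this path also minimizes
  it on a translate of \<open>Z\<close>, since it is \<open>\<Sum> w / 2\<close> plus, for each pair of vectors, the earlier
  of the two. By separation, the monotone path polytope and the translate of \<open>Z/n\<close> have the same sum
  with the upward ray. The upper facet of the pile lies in \<open>\<lambda>\<^sub>1x\<^sub>1 + \<dots> + \<lambda>\<^sub>dx\<^sub>d = x\<^sub>d\<^sub>+\<^sub>1\<close>, so any path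
  can be raised to this hyperplane, and the polytope is everything between its lower part and it.
\<close>

section \<open>Convexity\<close>

lemma sum_mem_set_sum:
  fixes S :: "'i \<Rightarrow> 'a::comm_monoid_add set"
  assumes "finite I" "\<And>i. i \<in> I \<Longrightarrow> f i \<in> S i"
  shows "sum f I \<in> sum S I"
  using assms by (auto simp: set_sum_alt)

text \<open>Minimizing a linear functional over a Minkowski sum splits into independent
  minimizations over the summands.\<close>

lemma set_sum_bound_below:
  fixes S :: "'i \<Rightarrow> 'a::real_inner set"
  assumes "finite I" "x \<in> sum S I" "\<And>i y. i \<in> I \<Longrightarrow> y \<in> S i \<Longrightarrow> g i \<le> c \<bullet> y"
  shows "sum g I \<le> c \<bullet> x"
proof -
  obtain f where "x = sum f I" "\<forall>i\<in>I. f i \<in> S i"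
    using assms(1,2) by (auto simp: set_sum_alt)
  then show ?thesis
    using assms(3) by (auto simp: inner_sum_right intro!: sum_mono)
qed

lemma compact_set_plus:
  fixes S T :: "'a::real_normed_vector set"
  assumes "compact S" "compact T"
  shows "compact (S + T)"
proof -
  have "S + T = {x + y |x y. x \<in> S \<and> y \<in> T}"
    by (auto simp: set_plus_def)
  then show ?thesis
    using compact_sums[OF assms] by simp
qed

lemma compact_set_sum:
  fixes S :: "'i \<Rightarrow> 'a::real_normed_vector set"
  assumes "\<And>i. i \<in> I \<Longrightarrow> compact (S i)"
  shows "compact (sum S I)"
  using assms by (induction I rule: infinite_finite_induct) (auto intro: compact_set_plus)

text \<open>Only functionals with nonnegative last coefficient can separate from a set that is closed
  under moving up.\<close>

lemma above_compact_convexI: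
  fixes K :: "('a::euclidean_space \<times> real) set"
  assumes "compact K" "convex K" "K \<noteq> {}"
    and below: "\<And>c. 0 \<le> snd c \<Longrightarrow> \<exists>q\<in>K. c \<bullet> q \<le> c \<bullet> z"
  shows "\<exists>q\<in>K. \<exists>\<tau>\<ge>0. z = q + (0, \<tau>)"
proof (rule ccontr)
  \<comment> \<open>The upward ray; its sum with \<open>K\<close> is closed because \<open>K\<close>
    is compact.\<close>
  define R where "R = ({0::'a} \<times> {0::real..})"
  define S where "S = (\<Union>x\<in>R. \<Union>y\<in>K. {x + y})"
  assume contra: "\<not> ?thesis"
  have "z \<notin> S"
    using contra by (force simp: S_def R_def add.commute)
  moreover have "closed S"
    unfolding S_def R_def by (intro closed_compact_sums closed_Times assms) auto
  moreover have "convex S"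
    unfolding S_def R_def by (intro convex_sums convex_Times assms) auto
  ultimately obtain c b where c: "c \<bullet> z < b" "\<And>x. x \<in> S \<Longrightarrow> b < c \<bullet> x"
    using separating_hyperplane_closed_point[of S z] by blast
  have above: "b < c \<bullet> q + snd c * \<tau>" if "q \<in> K" "\<tau> \<ge> 0" for q \<tau>
  proof -
    have "(0, \<tau>) + q \<in> S"
      using that by (auto simp: S_def R_def)
    from c(2)[OF this] show ?thesis
      by (cases c) (auto simp: inner_add_right)
  qed
  have "0 \<le> snd c"
  proof (rule ccontr)
    assume neg: "\<not> 0 \<le> snd c"
    obtain q where q: "q \<in> K" using assms(3) by blast
    \<comment> \<open>At this height the right-hand side of \<open>above\<close> equals
      \<open>b\<close> exactly.\<close>
    define \<tau> where "\<tau> = (c \<bullet> q - b) / - snd c"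
    have "\<tau> \<ge> 0"
      using above[OF q, of 0] neg by (simp add: \<tau>_def divide_simps)
    from above[OF q this] show False
      using neg by (simp add: \<tau>_def)
  qed
  then obtain q where "q \<in> K" "c \<bullet> q \<le> c \<bullet> z"
    using below by blast
  with above[of q 0] c(1) show False by simp
qed

section \<open>Rankings of a finite set\<close>

text \<open>Applied to the cells of one direction that a path has already passed, so that they form
  an initial segment.\<close>

lemma card_downset_nat:
  fixes D :: "nat set"
  assumes "finite D" "\<And>k l. l \<in> D \<Longrightarrow> k < l \<Longrightarrow> k \<in> D"
  shows "D = {..<card D}"
proof (cases "D = {}")
  case False
  then have "Max D \<in> D" using assms(1) by simp
  then have "D = {..Max D}"
    using assms by (intro set_eqI iffI) (simp, metis atMost_iff le_neq_implies_less)
  then obtain m where "D = {..m}" ..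
  then show ?thesis by (simp add: lessThan_Suc_atMost)
qed simp

text \<open>The rank of an element counts the elements before it: transitivity makes it strictly
  increasing, and totality then makes it injective.\<close>

lemma ex_ranking:
  assumes "finite A" "irreflp_on A R" "transp_on A R" "totalp_on A R"
  shows "\<exists>r. bij_betw r A {..<card A} \<and> (\<forall>x\<in>A. \<forall>y\<in>A. R x y \<longrightarrow> r x < r y)"
proof -
  define r where "r x = card {y\<in>A. R y x}" for x
  have mono: "r x < r y" if "x \<in> A" "y \<in> A" "R x y" for x y
  proof -
    have "{z\<in>A. R z x} \<subset> {z\<in>A. R z y}"
      using assms that by (auto simp: irreflp_on_def dest: transp_onD)
    then show ?thesis
      unfolding r_def using assms(1) by (simp add: psubset_card_mono)
  qed
  then have inj: "inj_on r A"
    using assms(4) by (intro inj_onI) (metis less_irrefl totalp_onD)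
  have "r x < card A" if "x \<in> A" for x
    unfolding r_def using that assms(1,2)
    by (intro psubset_card_mono) (auto simp: irreflp_on_def)
  then have "r ` A = {..<card A}"
    using inj by (intro card_subset_eq) (auto simp: card_image)
  then show ?thesis
    using inj mono by (auto simp: bij_betw_def)
qed

section \<open>Clamping to the unit interval\<close>

text \<open>At unit speed, \<open>clamp01 (t - real r)\<close> is the fraction completed by time
  \<open>t\<close> of a step that starts at time \<open>r\<close>.\<close>

definition clamp01 :: "real \<Rightarrow> real" where
  "clamp01 u = max 0 (min 1 u)"

text \<open>Between consecutive integers the clamp is affine, so its values 0 or 1 at the two ends
  determine it.\<close>

lemma clamp01_interpolate:
  assumes "0 \<le> \<theta>" "\<theta> \<le> 1"
  shows "clamp01 (real m + \<theta> - real q) =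
    (1 - \<theta>) * of_bool (q < m) + \<theta> * of_bool (q < Suc m)"
proof -
  consider "q < m" | "q = m" | "q > m" by linarith
  then show ?thesis
  proof cases
    case 1
    then have "real q + 1 \<le> real m" by linarith
    with 1 assms show ?thesis by (auto simp: clamp01_def)
  next
    case 3
    then have "real m + 1 \<le> real q" by linarith
    with 3 assms show ?thesis by (auto simp: clamp01_def)
  qed (use assms in \<open>auto simp: clamp01_def\<close>)
qed

text \<open>Zero before time \<open>r\<close>, a ramp of area 1/2, then constant 1 up to
  \<open>N\<close>: the three pieces are integrated separately.\<close>

lemma has_integral_clamp01:
  assumes "r < N"
  shows "((\<lambda>t. clamp01 (t - real r)) has_integral (real N - real r - 1 / 2)) {0..real N}"
proof -
  have le: "real r + 1 \<le> real N" using assms by linarith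
  have "((\<lambda>t. clamp01 (t - real r)) has_integral 0) {0..real r}"
    by (rule has_integral_is_0) (auto simp: clamp01_def)
  moreover have "((\<lambda>t. clamp01 (t - real r)) has_integral 1 / 2) {real r..real r + 1}"
  proof (rule has_integral_eq)
    have "((\<lambda>t. t - real r) has_integral
        ((real r + 1 - real r)\<^sup>2 / 2 - (real r - real r)\<^sup>2 / 2)) {real r..real r + 1}"
      by (rule fundamental_theorem_of_calculus)
        (auto intro!: derivative_eq_intros
          simp flip: has_real_derivative_iff_has_vector_derivative)
    then show "((\<lambda>t. t - real r) has_integral 1 / 2) {real r..real r + 1}" by simp
  qed (auto simp: clamp01_def)
  ultimately have 1: "((\<lambda>t. clamp01 (t - real r)) has_integral 0 + 1 / 2) {0..real r + 1}"
    by (rule has_integral_combine[rotated 2]) auto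
  have 2: "((\<lambda>t. clamp01 (t - real r)) has_integral (real N - (real r + 1)))
      {real r + 1..real N}"
  proof (rule has_integral_eq)
    show "((\<lambda>t. 1) has_integral (real N - (real r + 1))) {real r + 1..real N}"
      using has_integral_const_real[of "1::real" "real r + 1" "real N"] le by simp
  qed (auto simp: clamp01_def)
  have "((\<lambda>t. clamp01 (t - real r)) has_integral (0 + 1 / 2) + (real N - (real r + 1)))
      {0..real N}"
    using le by (intro has_integral_combine[OF _ _ 1 2]) auto
  then show ?thesis by (simp add: algebra_simps)
qed

section \<open>The pile of cubes\<close>

definition cells :: "('d::finite \<Rightarrow> nat) \<Rightarrow> ('d \<times> nat) set" where
  "cells lam = (SIGMA i:UNIV. {..<lam i})"

text \<open>The \<open>k\<close>-th edge in direction \<open>i\<close> of the lifted integer points: \<open>2k + 1 = (k + 1)\<^sup>2 - k\<^sup>2\<close>.\<close>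

definition step :: "'d::finite \<times> nat \<Rightarrow> (real ^ 'd) \<times> real" where
  "step \<alpha> = (axis (fst \<alpha>) 1, 2 * real (snd \<alpha>) + 1)"

text \<open>The graph of this function is the cutting hyperplane.\<close>

definition linear_lift :: "('d::finite \<Rightarrow> nat) \<Rightarrow> real ^ 'd \<Rightarrow> real" where
  "linear_lift lam x = (\<Sum>i\<in>UNIV. real (lam i) * x $ i)"

lemma finite_cells [simp]: "finite (cells lam)"
  by (simp add: cells_def)

lemma card_cells: "card (cells lam) = (\<Sum>i\<in>UNIV. lam i)"
  by (simp add: cells_def)

lemma sum_cells: "sum f (cells lam) = (\<Sum>i\<in>UNIV. \<Sum>k<lam i. f (i, k))"
  by (simp add: cells_def sum.Sigma)

lemma inner_step: "c \<bullet> step (i, k) = fst c $ i + snd c * (2 * real k + 1)"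
  by (cases c) (simp add: step_def inner_axis)

lemma linear_coord_sum: "linear coord_sum"
  by (rule linearI) (auto simp: coord_sum_def sum.distrib sum_distrib_left)

lemma coord_sum_step [simp]: "coord_sum (step \<alpha>) = 1"
  by (simp add: coord_sum_def step_def axis_def if_distrib cong: if_cong)

lemma bounded_linear_linear_lift: "bounded_linear (linear_lift lam)"
  unfolding linear_conv_bounded_linear[symmetric]
  by (rule linearI) (auto simp: linear_lift_def sum.distrib sum_distrib_left algebra_simps)

lemma sum_odd: "(\<Sum>k<m. 2 * real k + 1) = (real m)\<^sup>2"
  by (induction m) (auto simp: power2_eq_square algebra_simps)

text \<open>In each direction consecutive odd numbers add up to a square, so completing the first
  \<open>h i\<close> steps for every \<open>i\<close> leads to a lifted lattice point.\<close>

lemma sum_step: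
  fixes h :: "'d::finite \<Rightarrow> nat"
  shows "(\<Sum>\<alpha>\<in>Sigma UNIV (\<lambda>i. {..<h i}). step \<alpha>) =
    ((\<chi> i. real (h i)), sum_of_squares (\<chi> i. real (h i)))"
proof -
  have "(\<Sum>\<alpha>\<in>Sigma UNIV (\<lambda>i. {..<h i}). step \<alpha>) = (\<Sum>i\<in>UNIV. \<Sum>k<h i. step (i, k))"
    by (simp add: sum.Sigma)
  also have "\<dots> = (\<Sum>i\<in>UNIV. (real (h i) *\<^sub>R axis i 1, (real (h i))\<^sup>2))"
    by (intro sum.cong refl)
      (simp add: step_def sum_prod sum_odd sum_constant_scaleR del: sum_constant)
  also have "\<dots> = ((\<chi> i. real (h i)), sum_of_squares (\<chi> i. real (h i)))"
    by (auto simp: sum_prod sum_of_squares_def vec_eq_iff axis_def if_distrib cong: if_cong)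
  finally show ?thesis .
qed

text \<open>Recording a lattice point of the box by its natural coordinates \<open>h\<close> turns
  it into a subset of the cells, which makes generators comparable with staircases.\<close>

lemma pile_generators:
  "(\<lambda>x. (x, sum_of_squares x)) ` (box_of lam \<inter> integer_points) =
    {\<Sum>\<alpha>\<in>Sigma UNIV (\<lambda>i. {..<h i}). step \<alpha> |h. \<forall>i. h i \<le> lam i}"
proof (intro set_eqI iffI; clarsimp simp only: sum_step)
  fix x assume x: "x \<in> box_of lam" "x \<in> integer_points"
  have "\<exists>m. x $ i = real m \<and> m \<le> lam i" for i
  proof -
    have "x $ i \<in> \<int>" "0 \<le> x $ i" "x $ i \<le> real (lam i)"
      using x by (auto simp: box_of_def integer_points_def)
    then show ?thesis
      by (metis Ints_cases of_int_0_le_iff of_nat_le_iff of_nat_nat of_int_of_nat_eq)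
  qed
  then obtain h where "\<And>i. x $ i = real (h i) \<and> h i \<le> lam i" by metis
  then have "x = (\<chi> i. real (h i))" "\<forall>i. h i \<le> lam i" by (auto simp: vec_eq_iff)
  then show "\<exists>h. (x, sum_of_squares x) =
      ((\<chi> i. real (h i)), sum_of_squares (\<chi> i. real (h i))) \<and> (\<forall>i. h i \<le> lam i)"
    by blast
next
  fix h assume "\<forall>i. h i \<le> lam i"
  then show "((\<chi> i. real (h i)), sum_of_squares (\<chi> i. real (h i)))
      \<in> (\<lambda>x. (x, sum_of_squares x)) ` (box_of lam \<inter> integer_points)"
    by (intro imageI) (auto simp: box_of_def integer_points_def)
qed

section \<open>Inequalities on the pile of cubes and its upper facet\<close>

lemma convex_pile: "convex (lifted_pile_of_cubes lam)"
  by (simp add: lifted_pile_of_cubes_def)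

lemma sum_step_in_pile:
  assumes "\<forall>i. h i \<le> lam i"
  shows "(\<Sum>\<alpha>\<in>Sigma UNIV (\<lambda>i. {..<h i}). step \<alpha>) \<in> lifted_pile_of_cubes lam"
  unfolding lifted_pile_of_cubes_def pile_generators using assms
  by (intro hull_inc) blast

text \<open>A lattice coordinate between 0 and \<open>lam i\<close> has square at most
  \<open>lam i\<close> times itself; this and the box inequalities define a convex set, hence
  survive in the hull.\<close>

lemma pile_below_linear_lift:
  assumes "p \<in> lifted_pile_of_cubes lam"
  shows "fst p \<in> box_of lam" "snd p \<le> linear_lift lam (fst p)"
proof -
  define S where "S = {p. (\<forall>i. 0 \<le> fst p $ i \<and> fst p $ i \<le> real (lam i)) \<and>
    snd p \<le> linear_lift lam (fst p)}"
  have "linear (linear_lift lam)"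
    using bounded_linear_linear_lift bounded_linear.linear by blast
  then have "convex S"
    unfolding S_def
    by (auto simp: convex_alt linear_add linear_scale intro!: convex_bound_le add_mono mult_left_mono)
  moreover have "(\<lambda>x. (x, sum_of_squares x)) ` (box_of lam \<inter> integer_points) \<subseteq> S"
    by (auto simp: S_def box_of_def linear_lift_def sum_of_squares_def power2_eq_square
        intro!: sum_mono mult_right_mono)
  ultimately have "lifted_pile_of_cubes lam \<subseteq> S"
    unfolding lifted_pile_of_cubes_def by (rule hull_minimal[rotated])
  then show "fst p \<in> box_of lam" "snd p \<le> linear_lift lam (fst p)"
    using assms by (auto simp: S_def box_of_def)
qed

text \<open>The upper facet: \<open>f\<close> agrees with the linear lift at the vertices of the box.\<close>

lemma linear_lift_in_pile:
  fixes lam :: "'d::finite \<Rightarrow> nat"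
  assumes "\<forall>i. 0 < lam i" "x \<in> box_of lam"
  shows "(x, linear_lift lam x) \<in> lifted_pile_of_cubes lam"
proof -
  \<comment> \<open>\<open>g\<close> stretches the unit cube to the box and lifts it linearly, so
    the point wanted is \<open>g y\<close> with \<open>y\<close> in the hull of the vertices
    \<open>V\<close> of the cube.\<close>
  define g :: "real ^ 'd \<Rightarrow> (real ^ 'd) \<times> real" where
    "g y = ((\<chi> i. real (lam i) * y $ i), linear_lift lam (\<chi> i. real (lam i) * y $ i))" for y
  define y :: "real ^ 'd" where "y = (\<chi> i. x $ i / real (lam i))"
  define V :: "(real ^ 'd) set" where "V = {y. \<forall>b\<in>Basis. y \<bullet> b = 0 \<or> y \<bullet> b = 1}"
  have lin: "linear g"
    unfolding g_def
    by (rule linearI)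
      (auto simp: linear_lift_def vec_eq_iff sum.distrib sum_distrib_left algebra_simps)
  have "0 \<le> y \<bullet> b \<and> y \<bullet> b \<le> 1" if b: "b \<in> Basis" for b
  proof -
    obtain i where "b = axis i 1" using b by (auto simp: Basis_vec_def)
    then show ?thesis
      using assms by (simp add: y_def box_of_def inner_axis)
  qed
  then have "y \<in> cbox 0 One" by (simp add: mem_box)
  then have "y \<in> convex hull V"
    unfolding V_def unit_interval_convex_hull .
  then have gy: "g y \<in> convex hull (g ` V)"
    using convex_hull_linear_image[OF lin] by blast
  have "g ` V \<subseteq> (\<lambda>x. (x, sum_of_squares x)) ` (box_of lam \<inter> integer_points)"
  proof
    fix p assume "p \<in> g ` V"
    then obtain v where v: "p = g v" "v \<in> V" by blast
    then have v01: "v $ i = 0 \<or> v $ i = 1" for i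
      by (auto simp: V_def Basis_vec_def inner_axis)
    \<comment> \<open>The linear lift agrees with the sum of squares here because each coordinate of
      \<open>v\<close> is its own square.\<close>
    have "real (lam i) * (real (lam i) * v $ i) = (real (lam i) * v $ i)\<^sup>2" for i
      using v01[of i] by (auto simp: power2_eq_square)
    then have "p = (fst p, sum_of_squares (fst p))"
      by (simp add: v(1) g_def sum_of_squares_def linear_lift_def)
    moreover have "0 \<le> fst p $ i \<and> fst p $ i \<le> real (lam i) \<and> fst p $ i \<in> \<int>" for i
      using v01[of i] by (auto simp: v(1) g_def)
    then have "fst p \<in> box_of lam \<inter> integer_points"
      by (simp add: box_of_def integer_points_def)
    ultimately show "p \<in> (\<lambda>x. (x, sum_of_squares x)) ` (box_of lam \<inter> integer_points)"
      by blast
  qed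
  then have "convex hull (g ` V) \<subseteq> lifted_pile_of_cubes lam"
    unfolding lifted_pile_of_cubes_def by (rule hull_mono)
  moreover have "g y = (x, linear_lift lam x)"
  proof -
    have "lam i \<noteq> 0" for i using assms(1) by (metis less_irrefl)
    then have "(\<chi> i. real (lam i) * y $ i) = x" by (simp add: y_def vec_eq_iff)
    then show ?thesis by (simp add: g_def)
  qed
  ultimately show ?thesis using gy by auto
qed

section \<open>Staircase paths\<close>

text \<open>\<open>r\<close> gives the time at which each step begins. The second condition keeps
  the steps of one direction in order, so that partial sums are lifted lattice points.\<close>

definition shuffle :: "('d::finite \<Rightarrow> nat) \<Rightarrow> ('d \<times> nat \<Rightarrow> nat) \<Rightarrow> bool" where
  "shuffle lam r \<longleftrightarrow> bij_betw r (cells lam) {..<card (cells lam)} \<and>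
    (\<forall>i k l. k < l \<longrightarrow> l < lam i \<longrightarrow> r (i, k) < r (i, l))"

definition staircase ::
    "('d::finite \<Rightarrow> nat) \<Rightarrow> ('d \<times> nat \<Rightarrow> nat) \<Rightarrow> real \<Rightarrow> (real ^ 'd) \<times> real" where
  "staircase lam r t = (\<Sum>\<alpha>\<in>cells lam. clamp01 (t - real (r \<alpha>)) *\<^sub>R step \<alpha>)"

definition staircase_integral ::
    "('d::finite \<Rightarrow> nat) \<Rightarrow> ('d \<times> nat \<Rightarrow> nat) \<Rightarrow> (real ^ 'd) \<times> real" where
  "staircase_integral lam r =
    (\<Sum>\<alpha>\<in>cells lam. (real (card (cells lam)) - real (r \<alpha>) - 1 / 2) *\<^sub>R step \<alpha>)"

lemma continuous_on_staircase: "continuous_on S (staircase lam r)"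
  unfolding staircase_def clamp01_def by (intro continuous_intros)

lemma has_integral_staircase:
  assumes "shuffle lam r"
  shows "(staircase lam r has_integral staircase_integral lam r) {0..real (card (cells lam))}"
  unfolding staircase_def[abs_def] staircase_integral_def
proof (rule has_integral_sum)
  fix \<alpha> assume "\<alpha> \<in> cells lam"
  then have "r \<alpha> < card (cells lam)"
    using assms by (auto simp: shuffle_def bij_betw_def)
  from has_integral_scaleR_left[OF has_integral_clamp01[OF this]]
  show "((\<lambda>t. clamp01 (t - real (r \<alpha>)) *\<^sub>R step \<alpha>) has_integral
      (real (card (cells lam)) - real (r \<alpha>) - 1 / 2) *\<^sub>R step \<alpha>) {0..real (card (cells lam))}" .
qed simp

lemma unit_cell:
  fixes t :: real
  assumes "0 < N" "t \<in> {0..real N}"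
  obtains m \<theta> where "m < N" "0 \<le> \<theta>" "\<theta> \<le> 1" "t = real m + \<theta>"
\<comment> \<open>At the right end the floor would give \<open>m = N\<close>; the last interval with
  \<theta> = 1 is used instead.\<close>
proof (cases "t = real N")
  case True
  with assms that[of "N - 1" 1] show ?thesis by auto
next
  case False
  with assms have "nat \<lfloor>t\<rfloor> < N" "real (nat \<lfloor>t\<rfloor>) \<le> t"
    by (auto simp: nat_less_iff floor_less_iff)
  moreover have "t \<le> real (nat \<lfloor>t\<rfloor>) + 1" by linarith
  ultimately  show ?thesis
    by (intro that[of "nat \<lfloor>t\<rfloor>" "t - real (nat \<lfloor>t\<rfloor>)"]; linarith)
qed

lemma staircase_interpolate:
  assumes "0 \<le> \<theta>" "\<theta> \<le> 1"
  shows "staircase lam r (real m + \<theta>) =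
    (1 - \<theta>) *\<^sub>R (\<Sum>\<alpha>\<in>{\<alpha>\<in>cells lam. r \<alpha> < m}. step \<alpha>) +
    \<theta> *\<^sub>R (\<Sum>\<alpha>\<in>{\<alpha>\<in>cells lam. r \<alpha> < Suc m}. step \<alpha>)"
proof -
  have *: "(\<Sum>\<alpha>\<in>{\<alpha>\<in>cells lam. r \<alpha> < m}. step \<alpha>) =
      (\<Sum>\<alpha>\<in>cells lam. of_bool (r \<alpha> < m) *\<^sub>R step \<alpha>)" for m
    by (rule sum.mono_neutral_cong_left) auto
  show ?thesis
    unfolding * staircase_def clamp01_interpolate[OF assms]
    by (simp add: scaleR_sum_right scaleR_add_left sum.distrib)
qed

text \<open>The cells of rank below \<open>m\<close> fill an initial segment in each direction, so
  their steps sum to a generator of the pile; bijectivity of \<open>r\<close> makes them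
  \<open>m\<close> in number, each raising \<open>coord_sum\<close> by 1.\<close>

lemma partial_staircase:
  assumes "shuffle lam r" "m \<le> card (cells lam)"
  defines "V \<equiv> \<Sum>\<alpha>\<in>{\<alpha>\<in>cells lam. r \<alpha> < m}. step \<alpha>"
  shows "V \<in> lifted_pile_of_cubes lam" "coord_sum V = real m"
proof -
  define h where "h i = card {k\<in>{..<lam i}. r (i, k) < m}" for i
  have "{k\<in>{..<lam i}. r (i, k) < m} = {..<h i}" for i
    unfolding h_def using assms(1) by (intro card_downset_nat) (auto simp: shuffle_def, fastforce)
  then have "{\<alpha>\<in>cells lam. r \<alpha> < m} = Sigma UNIV (\<lambda>i. {..<h i})"
    by (fastforce simp: cells_def)
  moreover have "h i \<le> lam i" for i
    unfolding h_def by (metis (no_types, lifting) card_lessThan card_mono finite_lessThan mem_Collect_eq subsetI)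
  ultimately show "V \<in> lifted_pile_of_cubes lam"
    unfolding V_def by (simp add: sum_step_in_pile)
  have "r ` {\<alpha>\<in>cells lam. r \<alpha> < m} = {..<m}"
  proof -
    have "r ` cells lam = {..<card (cells lam)}"
      using assms(1) by (auto simp: shuffle_def bij_betw_def)
    then have "{..<m} \<subseteq> r ` cells lam" using assms(2) by auto
    then show ?thesis by blast
  qed
  moreover have "inj_on r {\<alpha>\<in>cells lam. r \<alpha> < m}"
    using assms(1) by (auto simp: shuffle_def bij_betw_def intro: inj_on_subset)
  ultimately have "card {\<alpha>\<in>cells lam. r \<alpha> < m} = m"
    by (metis card_image card_lessThan)
  then show "coord_sum V = real m"
    unfolding V_def by (simp add: linear_sum[OF linear_coord_sum])
qed

lemma staircase_admissible:
  assumes "shuffle lam r" "0 < card (cells lam)" "t \<in> {0..real (card (cells lam))}"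
  shows "staircase lam r t \<in> lifted_pile_of_cubes lam" "coord_sum (staircase lam r t) = t"
proof -
  obtain m \<theta> where m: "m < card (cells lam)" "0 \<le> \<theta>" "\<theta> \<le> 1" "t = real m + \<theta>"
    using unit_cell[OF assms(2,3)] .
  show "staircase lam r t \<in> lifted_pile_of_cubes lam"
    unfolding m(4) staircase_interpolate[OF m(2,3)]
    using m by (intro convexD_alt[OF convex_pile] partial_staircase assms(1)) auto
  show "coord_sum (staircase lam r t) = t"
    unfolding m(4) staircase_interpolate[OF m(2,3)]
    using m partial_staircase(2)[OF assms(1)]
    by (simp add: linear_add[OF linear_coord_sum] linear_scale[OF linear_coord_sum])
      (simp add: algebra_simps)
qed

section \<open>Sorted staircases and their minimality on slices\<close>

definition sorts :: "('d::finite \<Rightarrow> nat) \<Rightarrow> (real ^ 'd) \<times> real \<Rightarrow> ('d \<times> nat \<Rightarrow> nat) \<Rightarrow> bool" where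
  "sorts lam c r \<longleftrightarrow>
    (\<forall>\<alpha>\<in>cells lam. \<forall>\<beta>\<in>cells lam. r \<alpha> < r \<beta> \<longrightarrow> c \<bullet> step \<alpha> \<le> c \<bullet> step \<beta>)"

text \<open>Ties are broken by the second index, so that the ranking is increasing in each direction.\<close>

lemma ex_sorting_shuffle:
  fixes lam :: "'d::{finite,linorder} \<Rightarrow> nat"
  assumes "0 \<le> snd c"
  shows "\<exists>r. shuffle lam r \<and> sorts lam c r"
proof -
  define R where "R \<alpha> \<beta> \<longleftrightarrow> c \<bullet> step \<alpha> < c \<bullet> step \<beta> \<or> c \<bullet> step \<alpha> = c \<bullet> step \<beta> \<and>
    (snd \<alpha> < snd \<beta> \<or> snd \<alpha> = snd \<beta> \<and> fst \<alpha> < fst \<beta>)" for \<alpha> \<beta> :: "'d \<times> nat"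
  have "\<exists>r. bij_betw r (cells lam) {..<card (cells lam)} \<and>
      (\<forall>\<alpha>\<in>cells lam. \<forall>\<beta>\<in>cells lam. R \<alpha> \<beta> \<longrightarrow> r \<alpha> < r \<beta>)"
    by (rule ex_ranking) (auto simp: R_def irreflp_on_def totalp_on_def intro!: transp_onI)
  then obtain r where r: "bij_betw r (cells lam) {..<card (cells lam)}"
    "\<And>\<alpha> \<beta>. \<alpha> \<in> cells lam \<Longrightarrow> \<beta> \<in> cells lam \<Longrightarrow> R \<alpha> \<beta> \<Longrightarrow> r \<alpha> < r \<beta>"
    by blast
  have "r (i, k) < r (i, l)" if "k < l" "l < lam i" for i k l
  proof (rule r(2))
    \<comment> \<open>A nonnegative last coefficient makes the functional weakly increase along each
      direction.\<close>
    have "snd c * (2 * real k + 1) \<le> snd c * (2 * real l + 1)"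
      using that assms by (intro mult_left_mono) auto
    then have "c \<bullet> step (i, k) \<le> c \<bullet> step (i, l)" by (simp add: inner_step)
    with that show "R (i, k) (i, l)" by (auto simp: R_def)
  qed (use that in \<open>auto simp: cells_def\<close>)
  moreover have "sorts lam c r"
    unfolding sorts_def
  proof (intro ballI impI)
    fix \<alpha> \<beta> assume "\<alpha> \<in> cells lam" "\<beta> \<in> cells lam" "r \<alpha> < r \<beta>"
    with r(2)[of \<beta> \<alpha>] have "\<not> R \<beta> \<alpha>" by auto
    then show "c \<bullet> step \<alpha> \<le> c \<bullet> step \<beta>" by (auto simp: R_def)
  qed
  ultimately show ?thesis using r(1) by (auto simp: shuffle_def)
qed

text \<open>Subtracting a multiple of \<open>coord_sum\<close>, which is constant on a slice, makes the steps of the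
  sorted staircase at height \<open>t\<close> exactly the steps on which the functional is negative.\<close>

lemma staircase_minimal:
  fixes lam :: "'d::finite \<Rightarrow> nat"
  assumes r: "shuffle lam r" "sorts lam c r" and "0 < card (cells lam)"
    and p: "p \<in> lifted_pile_of_cubes lam" "coord_sum p \<in> {0..real (card (cells lam))}"
  shows "c \<bullet> staircase lam r (coord_sum p) \<le> c \<bullet> p"
proof -
  let ?a = "\<lambda>\<alpha>. c \<bullet> step \<alpha>"
  obtain m \<theta> where m: "m < card (cells lam)" "0 \<le> \<theta>" "\<theta> \<le> 1" "coord_sum p = real m + \<theta>"
    using unit_cell[OF assms(3) p(2)] .
  have inj: "inj_on r (cells lam)" and "r ` cells lam = {..<card (cells lam)}"
    using r(1) by (auto simp: shuffle_def bij_betw_def)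
  then have "m \<in> r ` cells lam" using m(1) by simp
  then obtain \<mu> where \<mu>: "\<mu> \<in> cells lam" "r \<mu> = m" by blast
  \<comment> \<open>The value on the step \<open>\<mu>\<close> under way at this height; it is the
    multiple of \<open>coord_sum\<close> to subtract.\<close>
  define b where "b = ?a \<mu>"
  define L where "L q = c \<bullet> q - b * coord_sum q" for q
  have linL: "linear L"
    unfolding L_def by (intro linearI)
      (simp_all add: inner_add_right linear_add[OF linear_coord_sum]
        linear_scale[OF linear_coord_sum] algebra_simps)
  have Lstep: "L (step \<alpha>) = ?a \<alpha> - b" for \<alpha> by (simp add: L_def)
  \<comment> \<open>The least value of \<open>L\<close> on sums of steps over arbitrary subsets of
    the cells, attained by taking every negative step.\<close>
  define M where "M = (\<Sum>\<alpha>\<in>cells lam. min 0 (?a \<alpha> - b))"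
  have "(\<lambda>x. (x, sum_of_squares x)) ` (box_of lam \<inter> integer_points) \<subseteq> {q. M \<le> L q}"
    unfolding pile_generators
  proof (intro subsetI, elim CollectE exE conjE)
    fix q h assume q: "q = (\<Sum>\<alpha>\<in>Sigma UNIV (\<lambda>i. {..<h i}). step \<alpha>)" and h: "\<forall>i. h i \<le> lam i"
    have sub: "Sigma UNIV (\<lambda>i. {..<h i}) \<subseteq> cells lam"
      unfolding cells_def using h by (intro Sigma_mono) auto
    have "M = (\<Sum>\<alpha>\<in>cells lam - Sigma UNIV (\<lambda>i. {..<h i}). min 0 (?a \<alpha> - b)) +
        (\<Sum>\<alpha>\<in>Sigma UNIV (\<lambda>i. {..<h i}). min 0 (?a \<alpha> - b))"
      unfolding M_def by (rule sum.subset_diff[OF sub finite_cells])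
    moreover have "(\<Sum>\<alpha>\<in>cells lam - Sigma UNIV (\<lambda>i. {..<h i}). min 0 (?a \<alpha> - b)) \<le> 0"
      by (rule sum_nonpos) auto
    ultimately have "M \<le> (\<Sum>\<alpha>\<in>Sigma UNIV (\<lambda>i. {..<h i}). min 0 (?a \<alpha> - b))"
      by linarith
    also have "\<dots> \<le> (\<Sum>\<alpha>\<in>Sigma UNIV (\<lambda>i. {..<h i}). ?a \<alpha> - b)"
      by (intro sum_mono) auto
    also have "\<dots> = L (\<Sum>\<alpha>\<in>Sigma UNIV (\<lambda>i. {..<h i}). step \<alpha>)"
      by (simp add: linear_sum[OF linL] Lstep)
    finally show "q \<in> {q. M \<le> L q}" by (simp only: q mem_Collect_eq)
  qed
  moreover have "convex {q. M \<le> L q}"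
    using convex_linear_vimage[OF linL, of "{M..}"] by (simp add: vimage_def)
  ultimately have "lifted_pile_of_cubes lam \<subseteq> {q. M \<le> L q}"
    unfolding lifted_pile_of_cubes_def by (intro hull_minimal)
  with p have "M \<le> L p" by blast
  moreover have "L (staircase lam r (coord_sum p)) = M"
  proof -
    have "L (staircase lam r (coord_sum p)) =
        (\<Sum>\<alpha>\<in>cells lam. clamp01 (coord_sum p - real (r \<alpha>)) * (?a \<alpha> - b))"
      unfolding staircase_def
      by (simp add: linear_sum[OF linL] linear_scale[OF linL] Lstep)
    also have "\<dots> = M"
      unfolding M_def
    proof (rule sum.cong[OF refl])
      fix \<alpha> assume \<alpha>: "\<alpha> \<in> cells lam"
      \<comment> \<open>Steps before \<open>\<mu>\<close> are complete and nonpositive under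
        \<open>L\<close>, \<open>\<mu>\<close> itself contributes 0, and later steps are not begun
        and nonnegative.\<close>
      consider "r \<alpha> < m" | "r \<alpha> = m" | "r \<alpha> > m" by linarith
      then show "clamp01 (coord_sum p - real (r \<alpha>)) * (?a \<alpha> - b) = min 0 (?a \<alpha> - b)"
      proof cases
        case 1
        then have "?a \<alpha> \<le> b" using r(2) \<alpha> \<mu> by (auto simp: sorts_def b_def)
        with 1 show ?thesis unfolding m(4) clamp01_interpolate[OF m(2,3)] by simp
      next
        case 2
        then have "\<alpha> = \<mu>"
          using inj_onD[OF inj _ \<alpha> \<mu>(1)] \<mu>(2) by simp
        then show ?thesis by (simp add: b_def)
      next
        case 3
        then have "b \<le> ?a \<alpha>" using r(2) \<alpha> \<mu> by (auto simp: sorts_def b_def)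
        with 3 show ?thesis unfolding m(4) clamp01_interpolate[OF m(2,3)] by simp
      qed
    qed
    finally show ?thesis .
  qed
  moreover have "coord_sum (staircase lam r (coord_sum p)) = coord_sum p"
    using staircase_admissible(2) r(1) assms(3) p(2) by blast
  ultimately show ?thesis by (simp add: L_def)
qed

section \<open>The pair zonotope\<close>

text \<open>\<open>Z\<close> without its vertical segment: the heights 2k + 1 and 2l + 1 of two
  steps differ by 2l - 2k.\<close>

definition pair_zonotope :: "('d::{finite,linorder} \<Rightarrow> nat) \<Rightarrow> ((real ^ 'd::{finite,linorder}) \<times> real) set" where
  "pair_zonotope lam = (\<Sum>(i, j)\<in>{(i, j). i < j}. \<Sum>k<lam i. \<Sum>l<lam j.
     closed_segment 0 (step (j, l) - step (i, k)))"

text \<open>The integral of the path that traverses the directions one after another in increasing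
  order: half of every step and, for each pair of cells, the earlier step.\<close>

definition base_point :: "('d::{finite,linorder} \<Rightarrow> nat) \<Rightarrow> (real ^ 'd::{finite,linorder}) \<times> real" where
  "base_point lam = (\<Sum>\<alpha>\<in>cells lam. (1 / 2) *\<^sub>R step \<alpha>) +
     (\<Sum>i\<in>UNIV. \<Sum>k<lam i. \<Sum>l<lam i. if k < l then step (i, k) else 0) +
     (\<Sum>(i, j)\<in>{(i, j). i < j}. \<Sum>k<lam i. \<Sum>l<lam j. step (i, k))"

lemma zonotope_Z_eq:
  "zonotope_Z lam s = closed_segment 0 (s *\<^sub>R last_unit_vec) + pair_zonotope lam"
  unfolding zonotope_Z_def pair_zonotope_def
  by (simp add: step_def unit_vec_def last_unit_vec_def)

lemma compact_pair_zonotope: "compact (pair_zonotope lam)"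
  unfolding pair_zonotope_def by (auto intro!: compact_set_sum)

lemma convex_pair_zonotope: "convex (pair_zonotope lam)"
  unfolding pair_zonotope_def by (auto intro!: convex_set_sum)

lemma sum_pairs_linorder:
  fixes G :: "'d::{finite,linorder} \<Rightarrow> 'd \<Rightarrow> 'a::comm_monoid_add"
  shows "(\<Sum>i\<in>UNIV. \<Sum>j\<in>UNIV. G i j) =
    (\<Sum>i\<in>UNIV. G i i) + (\<Sum>(i, j)\<in>{(i, j). i < j}. G i j + G j i)"
proof -
  let ?A = "{(i, j). (i::'d) < j}" and ?B = "{(i, j). (j::'d) < i}" and ?D = "(\<lambda>i::'d. (i, i)) ` UNIV"
  have "(\<Sum>i\<in>UNIV. \<Sum>j\<in>UNIV. G i j) = (\<Sum>(i, j)\<in>UNIV \<times> UNIV. G i j)"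
    by (simp add: sum.cartesian_product)
  also have "UNIV \<times> UNIV = ?D \<union> (?A \<union> ?B)" by auto
  also have "(\<Sum>(i, j)\<in>?D \<union> (?A \<union> ?B). G i j) =
      (\<Sum>(i, j)\<in>?D. G i j) + ((\<Sum>(i, j)\<in>?A. G i j) + (\<Sum>(i, j)\<in>?B. G i j))"
    by (subst sum.union_disjoint, simp, simp, force, subst sum.union_disjoint) auto
  also have "(\<Sum>(i, j)\<in>?D. G i j) = (\<Sum>i\<in>UNIV. G i i)"
    by (subst sum.reindex) (auto simp: inj_on_def)
  also have "(\<Sum>(i, j)\<in>?B. G i j) = (\<Sum>(i, j)\<in>?A. G j i)"
    by (rule sum.reindex_bij_witness[of _ prod.swap prod.swap]) auto
  finally show ?thesis
    by (simp add: sum.distrib case_prod_unfold)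
qed

text \<open>The coefficient of \<open>step \<alpha>\<close> is \<open>1/2\<close> plus the number of cells that come after \<open>\<alpha>\<close>; each pair of
  cells thus contributes the step of the earlier one.\<close>

lemma staircase_integral_eq:
  fixes lam :: "'d::{finite,linorder} \<Rightarrow> nat"
  assumes r: "shuffle lam r"
  shows "staircase_integral lam r = base_point lam +
    (\<Sum>(i, j)\<in>{(i, j). i < j}. \<Sum>k<lam i. \<Sum>l<lam j.
      if r (i, k) < r (j, l) then 0 else step (j, l) - step (i, k))"
proof -
  let ?N = "card (cells lam)"
  have inj: "inj_on r (cells lam)" and im: "r ` cells lam = {..<?N}"
    using r by (auto simp: shuffle_def bij_betw_def)
  define G where "G i j = (\<Sum>k<lam i. \<Sum>l<lam j.
    if r (i, k) < r (j, l) then step (i, k) else 0)" for i j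
  have after: "(real ?N - real (r \<alpha>) - 1 / 2) *\<^sub>R step \<alpha> =
      (1 / 2) *\<^sub>R step \<alpha> + (\<Sum>\<beta>\<in>cells lam. if r \<alpha> < r \<beta> then step \<alpha> else 0)"
    if "\<alpha> \<in> cells lam" for \<alpha>
  proof -
    have "r \<alpha> < ?N" using im that by auto
    \<comment> \<open>The later cells are counted through their ranks, since the ranks exhaust
      \<open>{..<?N}\<close>.\<close>
    have "r ` {\<beta>\<in>cells lam. r \<alpha> < r \<beta>} = r ` cells lam \<inter> {r \<alpha><..}" by auto
    also have "\<dots> = {Suc (r \<alpha>)..<?N}" unfolding im by auto
    finally have "card (r ` {\<beta>\<in>cells lam. r \<alpha> < r \<beta>}) = ?N - Suc (r \<alpha>)" by simp
    moreover have "inj_on r {\<beta>\<in>cells lam. r \<alpha> < r \<beta>}"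
      by (rule inj_on_subset[OF inj]) auto
    ultimately have "card {\<beta>\<in>cells lam. r \<alpha> < r \<beta>} = ?N - Suc (r \<alpha>)"
      by (simp add: card_image)
    moreover have "(\<Sum>\<beta>\<in>cells lam. if r \<alpha> < r \<beta> then step \<alpha> else 0) =
        (\<Sum>\<beta>\<in>{\<beta>\<in>cells lam. r \<alpha> < r \<beta>}. step \<alpha>)"
      by (simp add: sum.inter_filter)
    ultimately have "(\<Sum>\<beta>\<in>cells lam. if r \<alpha> < r \<beta> then step \<alpha> else 0) =
        (real ?N - real (r \<alpha>) - 1) *\<^sub>R step \<alpha>"
      using \<open>r \<alpha> < ?N\<close> by (simp add: sum_constant_scaleR of_nat_diff)
    then show ?thesis by (simp flip: scaleR_add_left)
  qed
  have "(\<Sum>\<alpha>\<in>cells lam. \<Sum>\<beta>\<in>cells lam. if r \<alpha> < r \<beta> then step \<alpha> else 0) =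
      (\<Sum>i\<in>UNIV. \<Sum>k<lam i. \<Sum>j\<in>UNIV. \<Sum>l<lam j.
        if r (i, k) < r (j, l) then step (i, k) else 0)"
    by (simp only: sum_cells)
  also have "\<dots> = (\<Sum>i\<in>UNIV. \<Sum>j\<in>UNIV. G i j)"
    unfolding G_def by (intro sum.cong refl) (rule sum.swap)
  also have "\<dots> = (\<Sum>i\<in>UNIV. G i i) + (\<Sum>(i, j)\<in>{(i, j). i < j}. G i j + G j i)"
    by (rule sum_pairs_linorder)
  also have "(\<Sum>i\<in>UNIV. G i i) =
      (\<Sum>i\<in>UNIV. \<Sum>k<lam i. \<Sum>l<lam i. if k < l then step (i, k) else 0)"
  proof -
    \<comment> \<open>Within one direction every shuffle has the same order, so this part does not
      depend on \<open>r\<close>.\<close>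
    have "r (i, k) < r (i, l) \<longleftrightarrow> k < l" if "k < lam i" "l < lam i" for i k l
    proof -
      have "r (i, k') < r (i, l')" if "k' < l'" "l' < lam i" for k' l'
        using r that by (simp add: shuffle_def)
      from this[of k l] this[of l k] show ?thesis
        using that by (cases k l rule: linorder_cases) auto
    qed
    then show ?thesis unfolding G_def by (intro sum.cong refl) auto
  qed
  also have "(\<Sum>(i, j)\<in>{(i, j). i < j}. G i j + G j i) =
      (\<Sum>(i, j)\<in>{(i, j). i < j}. \<Sum>k<lam i. \<Sum>l<lam j. step (i, k)) +
      (\<Sum>(i, j)\<in>{(i, j). i < j}. \<Sum>k<lam i. \<Sum>l<lam j.
        if r (i, k) < r (j, l) then 0 else step (j, l) - step (i, k))"
    unfolding sum.distrib[symmetric]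
  proof (intro sum.cong refl, clarify)
    fix i j :: 'd assume "i < j"
    \<comment> \<open>Distinct cells have distinct ranks, so exactly one of the two conditionals
      below contributes its step.\<close>
    have ne: "r (i, k) \<noteq> r (j, l)" if "k < lam i" "l < lam j" for k l
      using inj_onD[OF inj, of "(i, k)" "(j, l)"] that \<open>i < j\<close> by (auto simp: cells_def)
    have "G j i = (\<Sum>k<lam i. \<Sum>l<lam j. if r (j, l) < r (i, k) then step (j, l) else 0)"
      unfolding G_def by (rule sum.swap)
    then have "G i j + G j i =
        (\<Sum>k<lam i. \<Sum>l<lam j. if r (i, k) < r (j, l) then step (i, k) else 0) +
        (\<Sum>k<lam i. \<Sum>l<lam j. if r (j, l) < r (i, k) then step (j, l) else 0)"
      by (simp only: G_def)
    also have "\<dots> = (\<Sum>k<lam i. \<Sum>l<lam j. step (i, k) +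
        (if r (i, k) < r (j, l) then 0 else step (j, l) - step (i, k)))"
      unfolding sum.distrib[symmetric]
    proof (intro sum.cong refl)
      fix k l assume "k \<in> {..<lam i}" "l \<in> {..<lam j}"
      then have "r (i, k) < r (j, l) \<or> r (j, l) < r (i, k)" using ne[of k l] by auto
      then show "(if r (i, k) < r (j, l) then step (i, k) else 0) +
          (if r (j, l) < r (i, k) then step (j, l) else 0) =
        step (i, k) + (if r (i, k) < r (j, l) then 0 else step (j, l) - step (i, k))" by auto
    qed
    finally show "G i j + G j i = (\<Sum>k<lam i. \<Sum>l<lam j. step (i, k)) +
        (\<Sum>k<lam i. \<Sum>l<lam j. if r (i, k) < r (j, l) then 0 else step (j, l) - step (i, k))"
      by (simp add: sum.distrib)
  qed
  finally have "(\<Sum>\<alpha>\<in>cells lam. (1 / 2) *\<^sub>R step \<alpha>) +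
      (\<Sum>\<alpha>\<in>cells lam. \<Sum>\<beta>\<in>cells lam. if r \<alpha> < r \<beta> then step \<alpha> else 0) =
    base_point lam + (\<Sum>(i, j)\<in>{(i, j). i < j}. \<Sum>k<lam i. \<Sum>l<lam j.
      if r (i, k) < r (j, l) then 0 else step (j, l) - step (i, k))"
    by (simp add: base_point_def add.assoc)
  then show ?thesis
    unfolding staircase_integral_def using after by (simp add: sum.distrib)
qed

text \<open>Each conditional term of \<open>staircase_integral_eq\<close> is an endpoint of its
  segment.\<close>

lemma staircase_integral_in_zonotope:
  fixes lam :: "'d::{finite,linorder} \<Rightarrow> nat"
  assumes "shuffle lam r"
  shows "\<exists>z\<in>pair_zonotope lam. staircase_integral lam r = base_point lam + z"
proof -
  have "(\<Sum>(i, j)\<in>{(i, j). i < j}. \<Sum>k<lam i. \<Sum>l<lam j.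
      if r (i, k) < r (j, l) then 0 else step (j, l) - step (i, k)) \<in> pair_zonotope lam"
    unfolding pair_zonotope_def
    by (rule sum_mem_set_sum, simp, clarify, rule sum_mem_set_sum, simp,
        rule sum_mem_set_sum) auto
  then show ?thesis
    unfolding staircase_integral_eq[OF assms] by blast
qed

text \<open>Sorting makes each conditional term the endpoint of its segment where \<open>c\<close>
  is smallest, and minima add over Minkowski sums.\<close>

lemma staircase_integral_minimal:
  fixes lam :: "'d::{finite,linorder} \<Rightarrow> nat"
  assumes r: "shuffle lam r" "sorts lam c r" and z: "z \<in> pair_zonotope lam"
  shows "c \<bullet> staircase_integral lam r \<le> c \<bullet> (base_point lam + z)"
proof -
  have seg: "c \<bullet> (if r (i, k) < r (j, l) then 0 else step (j, l) - step (i, k)) \<le> c \<bullet> x"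
    if "k < lam i" "l < lam j" and x: "x \<in> closed_segment 0 (step (j, l) - step (i, k))" for i j k l x
  proof -
    obtain u where u: "0 \<le> u" "u \<le> 1" "x = u *\<^sub>R (step (j, l) - step (i, k))"
      using x by (auto simp: closed_segment_def)
    have cells: "(i, k) \<in> cells lam" "(j, l) \<in> cells lam"
      using that(1,2) by (auto simp: cells_def)
    let ?e = "c \<bullet> (step (j, l) - step (i, k))"
    show ?thesis
    proof (cases "r (i, k) < r (j, l)")
      case True
      then have "0 \<le> ?e" using r(2) cells by (auto simp: sorts_def inner_diff_right)
      with True u show ?thesis by simp
    next
      case False
      have "?e \<le> 0"
      \<comment> \<open>Equal ranks occur only when the two cells coincide, and then the segment is
        a point.\<close>
      proof (cases "r (i, k) = r (j, l)")
        case True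
        then have "(i, k) = (j, l)"
          using r(1) cells by (auto simp: shuffle_def bij_betw_def dest: inj_onD)
        then show ?thesis by simp
      next
        case neq: False
        with False have "r (j, l) < r (i, k)" by simp
        then show ?thesis using r(2) cells by (auto simp: sorts_def inner_diff_right)
      qed
      then have "?e \<le> u * ?e" using u mult_right_mono_neg[of u 1 ?e] by simp
      with False u show ?thesis by simp
    qed
  qed
  have "(\<Sum>(i, j)\<in>{(i, j). i < j}. \<Sum>k<lam i. \<Sum>l<lam j.
      c \<bullet> (if r (i, k) < r (j, l) then 0 else step (j, l) - step (i, k))) \<le> c \<bullet> z"
    using z unfolding pair_zonotope_def
  proof (rule set_sum_bound_below[rotated], clarify)
    fix i j :: 'd and x
    assume "x \<in> (\<Sum>k<lam i. \<Sum>l<lam j. closed_segment 0 (step (j, l) - step (i, k)))"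
    then show "(\<Sum>k<lam i. \<Sum>l<lam j.
        c \<bullet> (if r (i, k) < r (j, l) then 0 else step (j, l) - step (i, k))) \<le> c \<bullet> x"
    proof (rule set_sum_bound_below[rotated])
      fix k y assume k: "k \<in> {..<lam i}"
        and y: "y \<in> (\<Sum>l<lam j. closed_segment 0 (step (j, l) - step (i, k)))"
      from y show "(\<Sum>l<lam j. c \<bullet> (if r (i, k) < r (j, l) then 0 else step (j, l) - step (i, k)))
          \<le> c \<bullet> y"
      proof (rule set_sum_bound_below[rotated])
        fix l x assume "l \<in> {..<lam j}" "x \<in> closed_segment 0 (step (j, l) - step (i, k))"
        with k show "c \<bullet> (if r (i, k) < r (j, l) then 0 else step (j, l) - step (i, k)) \<le> c \<bullet> x"
          by (intro seg) auto
      qed simp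
    qed simp
  qed simp
  then show ?thesis
    unfolding staircase_integral_eq[OF r(1)]
    by (simp add: inner_add_right inner_sum_right case_prod_unfold)
qed

section \<open>The monotone path polytope\<close>

definition monotone_path ::
    "('d::finite \<Rightarrow> nat) \<Rightarrow> (real \<Rightarrow> (real ^ 'd) \<times> real) \<Rightarrow> bool" where
  "monotone_path lam \<gamma> \<longleftrightarrow> continuous_on {0..real (card (cells lam))} \<gamma> \<and>
    (\<forall>t\<in>{0..real (card (cells lam))}. \<gamma> t \<in> lifted_pile_of_cubes lam \<and> coord_sum (\<gamma> t) = t)"

lemma monotone_path_polytope_eq:
  "monotone_path_polytope lam =
    {(1 / real (card (cells lam))) *\<^sub>R integral {0..real (card (cells lam))} \<gamma> |\<gamma>. monotone_path lam \<gamma>}"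
  unfolding monotone_path_polytope_def Let_def monotone_path_def card_cells ..

lemma monotone_path_integrable:
  "monotone_path lam \<gamma> \<Longrightarrow> \<gamma> integrable_on {0..real (card (cells lam))}"
  by (simp add: monotone_path_def integrable_continuous_real)

text \<open>Pointwise convex combinations of monotone paths are again monotone paths, and the
  integral is linear.\<close>

lemma convex_monotone_path_polytope: "convex (monotone_path_polytope lam)"
proof (rule convexI)
  fix p q and u v :: real
  assume p: "p \<in> monotone_path_polytope lam" and q: "q \<in> monotone_path_polytope lam"
    and uv: "0 \<le> u" "0 \<le> v" "u + v = 1"
  let ?N = "real (card (cells lam))"
  obtain \<gamma> where \<gamma>: "p = (1 / ?N) *\<^sub>R integral {0..?N} \<gamma>" "monotone_path lam \<gamma>"
    using p unfolding monotone_path_polytope_eq by blast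
  obtain \<delta> where \<delta>: "q = (1 / ?N) *\<^sub>R integral {0..?N} \<delta>" "monotone_path lam \<delta>"
    using q unfolding monotone_path_polytope_eq by blast
  have "monotone_path lam (\<lambda>t. u *\<^sub>R \<gamma> t + v *\<^sub>R \<delta> t)"
    unfolding monotone_path_def
  proof (intro conjI ballI)
    show "continuous_on {0..?N} (\<lambda>t. u *\<^sub>R \<gamma> t + v *\<^sub>R \<delta> t)"
      using \<gamma>(2) \<delta>(2) by (auto simp: monotone_path_def intro!: continuous_intros)
    fix t assume "t \<in> {0..?N}"
    then have t: "\<gamma> t \<in> lifted_pile_of_cubes lam" "\<delta> t \<in> lifted_pile_of_cubes lam"
      "coord_sum (\<gamma> t) = t" "coord_sum (\<delta> t) = t"
      using \<gamma>(2) \<delta>(2) by (auto simp: monotone_path_def)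
    show "u *\<^sub>R \<gamma> t + v *\<^sub>R \<delta> t \<in> lifted_pile_of_cubes lam"
      using t uv by (intro convexD[OF convex_pile])
    show "coord_sum (u *\<^sub>R \<gamma> t + v *\<^sub>R \<delta> t) = t"
      using t uv by (simp add: linear_add[OF linear_coord_sum] linear_scale[OF linear_coord_sum]
          flip: distrib_right)
  qed
  moreover have "u *\<^sub>R p + v *\<^sub>R q = (1 / ?N) *\<^sub>R integral {0..?N} (\<lambda>t. u *\<^sub>R \<gamma> t + v *\<^sub>R \<delta> t)"
    using monotone_path_integrable[OF \<gamma>(2)] monotone_path_integrable[OF \<delta>(2)]
    by (simp add: \<gamma>(1) \<delta>(1) integral_add integrable_cmul scaleR_add_right)
  ultimately show "u *\<^sub>R p + v *\<^sub>R q \<in> monotone_path_polytope lam"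
    unfolding monotone_path_polytope_eq by blast
qed

text \<open>Moves a linear functional or a linear lift inside the average, so that facts about the
  pile apply for each \<open>t\<close> separately.\<close>

lemma bounded_linear_path_mean:
  fixes h :: "(real ^ 'd::finite) \<times> real \<Rightarrow> 'b::euclidean_space"
  assumes "bounded_linear h" "monotone_path lam \<gamma>"
  shows "h ((1 / N) *\<^sub>R integral {0..real (card (cells lam))} \<gamma>) =
    (1 / N) *\<^sub>R integral {0..real (card (cells lam))} (\<lambda>t. h (\<gamma> t))"
  using integral_linear[OF monotone_path_integrable[OF assms(2)] assms(1)]
  by (simp add: o_def linear_scale[OF bounded_linear.linear[OF assms(1)]])

lemma monotone_path_polytope_below:
  assumes "p \<in> monotone_path_polytope lam"
  shows "snd p \<le> linear_lift lam (fst p)"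
proof -
  let ?N = "real (card (cells lam))" and ?h = "\<lambda>p. linear_lift lam (fst p) - snd p"
  obtain \<gamma> where \<gamma>: "p = (1 / ?N) *\<^sub>R integral {0..?N} \<gamma>" "monotone_path lam \<gamma>"
    using assms unfolding monotone_path_polytope_eq by blast
  have h: "bounded_linear ?h"
    by (intro bounded_linear_sub bounded_linear_compose[OF bounded_linear_linear_lift]
        bounded_linear_fst bounded_linear_snd)
  have "?h (\<gamma> t) \<ge> 0" if "t \<in> {0..?N}" for t
    using \<gamma>(2) that pile_below_linear_lift(2) by (fastforce simp: monotone_path_def)
  moreover have "(\<lambda>t. ?h (\<gamma> t)) integrable_on {0..?N}"
    using integrable_linear[OF monotone_path_integrable[OF \<gamma>(2)] h] by (simp add: o_def)
  ultimately have "integral {0..?N} (\<lambda>t. ?h (\<gamma> t)) \<ge> 0"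
    by (intro integral_nonneg)
  then have "?h p \<ge> 0"
    unfolding \<gamma>(1) bounded_linear_path_mean[OF h \<gamma>(2)] by simp
  then show ?thesis by simp
qed

text \<open>A path can be lifted vertically to the upper facet of the pile of cubes.\<close>

lemma monotone_path_polytope_raise:
  assumes lam: "\<forall>i. 0 < lam i" and p: "p \<in> monotone_path_polytope lam"
    and \<tau>: "0 \<le> \<tau>" "snd p + \<tau> \<le> linear_lift lam (fst p)"
  shows "p + (0, \<tau>) \<in> monotone_path_polytope lam"
proof -
  let ?N = "real (card (cells lam))" and ?h = "\<lambda>p. (fst p, linear_lift lam (fst p))"
  obtain \<gamma> where \<gamma>: "p = (1 / ?N) *\<^sub>R integral {0..?N} \<gamma>" "monotone_path lam \<gamma>"
    using p unfolding monotone_path_polytope_eq by blast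
  have h: "bounded_linear ?h"
    by (intro bounded_linear_Pair bounded_linear_compose[OF bounded_linear_linear_lift]
        bounded_linear_fst)
  have "monotone_path lam (\<lambda>t. ?h (\<gamma> t))"
    unfolding monotone_path_def
  proof (intro conjI ballI)
    show "continuous_on {0..?N} (\<lambda>t. ?h (\<gamma> t))"
      using \<gamma>(2) by (intro bounded_linear.continuous_on[OF h]) (simp add: monotone_path_def)
    fix t assume "t \<in> {0..?N}"
    then have "\<gamma> t \<in> lifted_pile_of_cubes lam" "coord_sum (\<gamma> t) = t"
      using \<gamma>(2) by (auto simp: monotone_path_def)
    then show "?h (\<gamma> t) \<in> lifted_pile_of_cubes lam" "coord_sum (?h (\<gamma> t)) = t"
      by (auto simp: coord_sum_def intro: linear_lift_in_pile[OF lam] pile_below_linear_lift(1))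
  qed
  moreover have "?h p = (1 / ?N) *\<^sub>R integral {0..?N} (\<lambda>t. ?h (\<gamma> t))"
    unfolding \<gamma>(1) by (rule bounded_linear_path_mean[OF h \<gamma>(2)])
  ultimately have top: "?h p \<in> monotone_path_polytope lam"
    unfolding monotone_path_polytope_eq by blast
  \<comment> \<open>The vertical distance from \<open>p\<close> to the top point; if it is positive,
    the target is the convex combination giving the top point the weight
    \<open>\<tau> / D\<close>.\<close>
  define D where "D = linear_lift lam (fst p) - snd p"
  show ?thesis
  proof (cases "D = 0")
    case True
    then have "\<tau> = 0" using \<tau> by (simp add: D_def)
    then show ?thesis using p by (simp add: zero_prod_def[symmetric])
  next
    case False
    then have D: "D > 0" "\<tau> \<le> D" using \<tau> by (auto simp: D_def)
    have hp: "?h p = p + (0, D)" by (simp add: D_def prod_eq_iff)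
    have "(1 - \<tau> / D) *\<^sub>R p + (\<tau> / D) *\<^sub>R ?h p \<in> monotone_path_polytope lam"
      using D \<tau>(1) by (intro convexD_alt[OF convex_monotone_path_polytope p top]) auto
    also have "(1 - \<tau> / D) *\<^sub>R p + (\<tau> / D) *\<^sub>R ?h p = p + (0, \<tau>)"
      unfolding hp using D by (simp add: scaleR_add_right scaleR_diff_left)
    finally show ?thesis .
  qed
qed

lemma monotone_path_staircase:
  "shuffle lam r \<Longrightarrow> 0 < card (cells lam) \<Longrightarrow> monotone_path lam (staircase lam r)"
  unfolding monotone_path_def using continuous_on_staircase staircase_admissible by blast

lemma staircase_integral_in_polytope:
  assumes "shuffle lam r" "0 < card (cells lam)"
  shows "(1 / real (card (cells lam))) *\<^sub>R staircase_integral lam r \<in> monotone_path_polytope lam"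
  unfolding monotone_path_polytope_eq
  using monotone_path_staircase[OF assms] integral_unique[OF has_integral_staircase[OF assms(1)]]
  by (intro CollectI exI[of _ "staircase lam r"]) simp

section \<open>Comparison of the polytope and the zonotope up to the upward ray\<close>

definition base_zonotope ::
    "('d::{finite,linorder} \<Rightarrow> nat) \<Rightarrow> ((real ^ 'd::{finite,linorder}) \<times> real) set" where
  "base_zonotope lam = (\<lambda>z. (1 / real (card (cells lam))) *\<^sub>R (base_point lam + z)) ` pair_zonotope lam"

lemma compact_base_zonotope: "compact (base_zonotope lam)"
  unfolding base_zonotope_def
  by (intro compact_continuous_image continuous_intros compact_pair_zonotope)

lemma convex_base_zonotope: "convex (base_zonotope lam)"
proof -
  have "base_zonotope lam =
      (*\<^sub>R) (1 / real (card (cells lam))) ` (+) (base_point lam) ` pair_zonotope lam"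
    by (auto simp: base_zonotope_def)
  then show ?thesis
    by (simp add: convex_scaling convex_translation convex_pair_zonotope)
qed

text \<open>For each \<open>c\<close> with nonnegative last coefficient the sorted staircase is at
  most the given path at every \<open>t\<close>, hence also in the mean, and its mean lies in the
  zonotope.\<close>

lemma polytope_above_base_zonotope:
  fixes lam :: "'d::{finite,linorder} \<Rightarrow> nat"
  assumes N: "0 < card (cells lam)" and p: "p \<in> monotone_path_polytope lam"
  shows "\<exists>q\<in>base_zonotope lam. \<exists>\<tau>\<ge>0. p = q + (0, \<tau>)"
proof (rule above_compact_convexI[OF compact_base_zonotope convex_base_zonotope])
  have in_base: "(1 / real (card (cells lam))) *\<^sub>R staircase_integral lam r \<in> base_zonotope lam"
    if "shuffle lam r" for r
    using staircase_integral_in_zonotope[OF that] by (auto simp: base_zonotope_def)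
  obtain r where "shuffle lam r"
    using ex_sorting_shuffle[of 0 lam] by auto
  then show "base_zonotope lam \<noteq> {}" using in_base by blast
  fix c :: "(real ^ 'd::{finite,linorder}) \<times> real" assume "0 \<le> snd c"
  then obtain r where r: "shuffle lam r" "sorts lam c r"
    using ex_sorting_shuffle by blast
  let ?N = "real (card (cells lam))"
  obtain \<gamma> where \<gamma>: "p = (1 / ?N) *\<^sub>R integral {0..?N} \<gamma>" "monotone_path lam \<gamma>"
    using p unfolding monotone_path_polytope_eq by blast
  have \<sigma>: "monotone_path lam (staircase lam r)"
    by (rule monotone_path_staircase[OF r(1) N])
  note c = bounded_linear_inner_right[of c]
  have "integral {0..?N} (\<lambda>t. c \<bullet> staircase lam r t) \<le> integral {0..?N} (\<lambda>t. c \<bullet> \<gamma> t)"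
  proof (rule integral_le)
    show "(\<lambda>t. c \<bullet> staircase lam r t) integrable_on {0..?N}" "(\<lambda>t. c \<bullet> \<gamma> t) integrable_on {0..?N}"
      using integrable_linear[OF monotone_path_integrable[OF \<sigma>] c]
        integrable_linear[OF monotone_path_integrable[OF \<gamma>(2)] c] by (simp_all add: o_def)
    fix t assume "t \<in> {0..?N}"
    then show "c \<bullet> staircase lam r t \<le> c \<bullet> \<gamma> t"
      using \<gamma>(2) staircase_minimal[OF r N, of "\<gamma> t"] by (simp add: monotone_path_def)
  qed
  then have "c \<bullet> ((1 / ?N) *\<^sub>R integral {0..?N} (staircase lam r)) \<le> c \<bullet> p"
    unfolding \<gamma>(1) bounded_linear_path_mean[OF c \<gamma>(2)] bounded_linear_path_mean[OF c \<sigma>]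
    by (simp add: divide_right_mono)
  then show "\<exists>q\<in>base_zonotope lam. c \<bullet> q \<le> c \<bullet> p"
    using in_base[OF r(1)] unfolding integral_unique[OF has_integral_staircase[OF r(1)]] by blast
qed

text \<open>The same sorted staircases minimize \<open>c\<close> over the zonotope, so separation
  also works in the other direction, with the convex hull of all staircase means as the compact
  set.\<close>

lemma base_zonotope_above_polytope:
  fixes lam :: "'d::{finite,linorder} \<Rightarrow> nat"
  assumes N: "0 < card (cells lam)" and q: "q \<in> base_zonotope lam"
  shows "\<exists>p\<in>monotone_path_polytope lam. \<exists>\<tau>\<ge>0. q = p + (0, \<tau>)"
proof -
  let ?N = "real (card (cells lam))"
  define K where "K = (\<lambda>r. (1 / ?N) *\<^sub>R staircase_integral lam r) ` {r. shuffle lam r}"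
  \<comment> \<open>A shuffle is arbitrary outside the cells; restricting it to them keeps its
    integral and leaves finitely many functions.\<close>
  have "K \<subseteq> (\<lambda>r. (1 / ?N) *\<^sub>R staircase_integral lam r) ` (cells lam \<rightarrow>\<^sub>E {..<card (cells lam)})"
  proof (unfold K_def, rule image_subsetI)
    fix r assume "r \<in> {r. shuffle lam r}"
    then have "restrict r (cells lam) \<in> cells lam \<rightarrow>\<^sub>E {..<card (cells lam)}"
      by (auto simp: shuffle_def bij_betw_def)
    moreover have "staircase_integral lam r = staircase_integral lam (restrict r (cells lam))"
      by (simp add: staircase_integral_def)
    ultimately show "(1 / ?N) *\<^sub>R staircase_integral lam r \<in>
        (\<lambda>r. (1 / ?N) *\<^sub>R staircase_integral lam r) ` (cells lam \<rightarrow>\<^sub>E {..<card (cells lam)})"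
      by (metis imageI)
  qed
  then have "finite K" by (rule finite_subset) (simp add: finite_PiE)
  have "\<exists>p\<in>convex hull K. \<exists>\<tau>\<ge>0. q = p + (0, \<tau>)"
  proof (rule above_compact_convexI)
    show "compact (convex hull K)"
      using \<open>finite K\<close> by (simp add: finite_imp_compact_convex_hull)
    show "convex hull K \<noteq> {}"
      using ex_sorting_shuffle[of 0 lam] by (auto simp: K_def)
    fix c :: "(real ^ 'd::{finite,linorder}) \<times> real" assume "0 \<le> snd c"
    then obtain r where r: "shuffle lam r" "sorts lam c r"
      using ex_sorting_shuffle by blast
    obtain z where z: "z \<in> pair_zonotope lam" "q = (1 / ?N) *\<^sub>R (base_point lam + z)"
      using q by (auto simp: base_zonotope_def)
    have "c \<bullet> ((1 / ?N) *\<^sub>R staircase_integral lam r) \<le> c \<bullet> q"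
      using staircase_integral_minimal[OF r z(1)] unfolding z(2) inner_scaleR_right
      by (intro mult_left_mono) auto
    moreover have "(1 / ?N) *\<^sub>R staircase_integral lam r \<in> convex hull K"
      using r(1) by (intro hull_inc) (auto simp: K_def)
    ultimately show "\<exists>q'\<in>convex hull K. c \<bullet> q' \<le> c \<bullet> q" by blast
  qed simp
  moreover have "convex hull K \<subseteq> monotone_path_polytope lam"
    unfolding K_def using staircase_integral_in_polytope[OF _ N]
    by (intro hull_minimal convex_monotone_path_polytope) auto
  ultimately show ?thesis by blast
qed

section \<open>Upper truncation\<close>

text \<open>The segment along the last axis scales to height \<open>s / N\<close> and thickens the
  base zonotope upwards.\<close>

lemma scaled_zonotope_eq:
  fixes lam :: "'d::{finite,linorder} \<Rightarrow> nat"
  assumes "0 \<le> s"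
  defines "N \<equiv> real (card (cells lam))"
  shows "(+) ((1 / N) *\<^sub>R base_point lam) ` (*\<^sub>R) (1 / N) ` zonotope_Z lam s =
    {q + (0, \<tau>) |q \<tau>. q \<in> base_zonotope lam \<and> 0 \<le> \<tau> \<and> \<tau> \<le> s / N}"
    (is "?L = ?R")
proof -
  have seg: "closed_segment 0 (s *\<^sub>R last_unit_vec) = (\<lambda>u. (0, u * s)) ` {0..1}"
    by (auto simp: closed_segment_def last_unit_vec_def)
  have "N \<ge> 0" by (simp add: N_def)
  show ?thesis
  proof (intro set_eqI iffI)
    fix x assume "x \<in> ?L"
    then obtain u z where u: "0 \<le> u" "u \<le> 1" and z: "z \<in> pair_zonotope lam"
      and x: "x = (1 / N) *\<^sub>R base_point lam + (1 / N) *\<^sub>R ((0, u * s) + z)"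
      by (auto simp: zonotope_Z_eq seg set_plus_def)
    have "x = (1 / N) *\<^sub>R (base_point lam + z) + (0, u * s / N)"
      by (simp add: x scaleR_add_right)
    moreover have "u * s / N \<le> s / N"
      using u assms(1) \<open>N \<ge> 0\<close> by (intro divide_right_mono mult_left_le_one_le)
    ultimately show "x \<in> ?R"
      using u z assms(1) \<open>N \<ge> 0\<close> unfolding base_zonotope_def N_def[symmetric]
      by (intro CollectI exI[of _ "(1 / N) *\<^sub>R (base_point lam + z)"] exI[of _ "u * s / N"]) auto
  next
    fix x assume "x \<in> ?R"
    then obtain z \<tau> where z: "z \<in> pair_zonotope lam" and \<tau>: "0 \<le> \<tau>" "\<tau> \<le> s / N"
      and x: "x = (1 / N) *\<^sub>R (base_point lam + z) + (0, \<tau>)"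
      unfolding base_zonotope_def N_def by blast
    have "\<exists>u\<in>{0..1}. \<tau> = u * s / N"
    \<comment> \<open>This case also covers \<open>N = 0\<close>, where division by 0 yields
      0.\<close>
    proof (cases "s / N = 0")
      case True
      with \<tau> have "\<tau> = 0" by simp
      then show ?thesis by (intro bexI[of _ 0]) auto
    next
      case False
      with \<tau> have "0 < s / N" by linarith
      with \<tau> have "\<tau> / (s / N) \<in> {0..1}" by (auto simp only: atLeastAtMost_iff divide_le_eq_1_pos divide_nonneg_pos)
      moreover have "\<tau> = \<tau> / (s / N) * s / N" using False by simp
      ultimately show ?thesis by blast
    qed
    then obtain u where u: "0 \<le> u" "u \<le> 1" "\<tau> = u * s / N" by auto
    have "x = (1 / N) *\<^sub>R base_point lam + (1 / N) *\<^sub>R ((0, u * s) + z)"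
      by (simp add: x u(3) scaleR_add_right)
    moreover have "(0, u * s) + z \<in> zonotope_Z lam s"
      unfolding zonotope_Z_eq seg using u z by (intro set_plus_intro imageI) auto
    ultimately show "x \<in> ?L" by blast
  qed
qed

text \<open>The translate of \<open>Z/n\<close> is the base zonotope \<open>K\<close> thickened upwards by \<open>\<sigma> = s/n\<close>; \<open>B\<close> bounds
  the vertical distance from \<open>K\<close> to the hyperplane.\<close>

lemma upper_truncation_thickening:
  fixes Q K :: "((real ^ 'd::finite) \<times> real) set"
  assumes below: "\<And>p. p \<in> Q \<Longrightarrow> snd p \<le> linear_lift lam (fst p)"
    and raise: "\<And>p \<tau>. p \<in> Q \<Longrightarrow> 0 \<le> \<tau> \<Longrightarrow> snd p + \<tau> \<le> linear_lift lam (fst p) \<Longrightarrow>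
      p + (0, \<tau>) \<in> Q"
    and QK: "\<And>p. p \<in> Q \<Longrightarrow> \<exists>q\<in>K. \<exists>\<tau>\<ge>0. p = q + (0, \<tau>)"
    and KQ: "\<And>q. q \<in> K \<Longrightarrow> \<exists>p\<in>Q. \<exists>\<tau>\<ge>0. q = p + (0, \<tau>)"
    and B: "\<And>q. q \<in> K \<Longrightarrow> linear_lift lam (fst q) - snd q \<le> B" "B \<le> \<sigma>" "0 \<le> \<sigma>"
  shows "upper_truncation Q {q + (0, \<tau>) |q \<tau>. q \<in> K \<and> 0 \<le> \<tau> \<and> \<tau> \<le> \<sigma>}
    {x. linear_lift lam (fst x) = snd x}"
proof -
  define T where "T = {q + (0, \<tau>) |q \<tau>. q \<in> K \<and> 0 \<le> \<tau> \<and> \<tau> \<le> \<sigma>}"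
  \<comment> \<open>The normal is signed so that \<open>a \<bullet> x \<le> 0\<close> means on or
    below the hyperplane.\<close>
  define a :: "(real ^ 'd) \<times> real" where "a = ((\<chi> i. - real (lam i)), 1)"
  have a: "a \<bullet> x = snd x - linear_lift lam (fst x)" for x
    by (cases x) (simp add: a_def inner_vec_def linear_lift_def sum_negf)
  have inner_up: "c \<bullet> (x + (0, \<tau>)) = c \<bullet> x + snd c * \<tau>"
    for c x :: "(real ^ 'd) \<times> real" and \<tau>
    by (cases c) (simp add: inner_add_right)
  have memT: "q + (0, \<tau>) \<in> T" if "q \<in> K" "0 \<le> \<tau>" "\<tau> \<le> \<sigma>" for q \<tau>
    unfolding T_def using that by blast
  have "Q \<subseteq> T"
  proof
    fix p assume p: "p \<in> Q"
    then obtain q \<tau> where q: "q \<in> K" "0 \<le> \<tau>" "p = q + (0, \<tau>)" using QK by blast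
    \<comment> \<open>\<open>p\<close> lies on or below the hyperplane, which is at most
      \<open>B\<close> above \<open>q\<close>.\<close>
    have "\<tau> \<le> \<sigma>" using below[OF p] B(1)[OF q(1)] B(2) by (simp add: q(3))
    with q memT show "p \<in> T" by blast
  qed
  have "T \<inter> {x. a \<bullet> x \<le> 0} \<subseteq> Q"
  proof
    fix x assume x: "x \<in> T \<inter> {x. a \<bullet> x \<le> 0}"
    then obtain q \<tau> where q: "q \<in> K" "0 \<le> \<tau>" "x = q + (0, \<tau>)" by (auto simp: T_def)
    from KQ[OF q(1)] obtain p \<tau>' where p: "p \<in> Q" "0 \<le> \<tau>'" "q = p + (0, \<tau>')" by blast
    \<comment> \<open>\<open>x\<close> lies vertically above a point of \<open>Q\<close> and not
      above the hyperplane, so that point can be raised to it.\<close>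
    have x_eq: "x = p + (0, \<tau>' + \<tau>)" by (simp add: q p add.assoc)
    show "x \<in> Q" unfolding x_eq
      using x p q by (intro raise) (auto simp: a x_eq)
  qed
  with \<open>Q \<subseteq> T\<close> have Q_eq: "Q = T \<inter> {x. a \<bullet> x \<le> 0}"
    using below by (auto simp: a)
  have "lower_part T \<subseteq> Q"
  proof
    fix x assume "x \<in> lower_part T"
    then obtain c where c: "snd c < 0" "x \<in> T" "\<And>y. y \<in> T \<Longrightarrow> c \<bullet> y \<le> c \<bullet> x"
      unfolding lower_part_def maximizers_def by blast
    then obtain q \<tau> where q: "q \<in> K" "0 \<le> \<tau>" "x = q + (0, \<tau>)" by (auto simp: T_def)
    from KQ[OF q(1)] obtain p \<tau>' where p: "p \<in> Q" "0 \<le> \<tau>'" "q = p + (0, \<tau>')" by blast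
    have x_eq: "x = p + (0, \<tau>' + \<tau>)" by (simp add: q p add.assoc)
    \<comment> \<open>Since \<open>p\<close> is in \<open>T\<close>, a maximizer for a negative last
      coefficient cannot lie strictly above it.\<close>
    have "c \<bullet> p \<le> c \<bullet> x" using c(3) p(1) \<open>Q \<subseteq> T\<close> by blast
    then have "0 \<le> snd c * (\<tau>' + \<tau>)" by (simp only: x_eq inner_up)
    then have "\<tau>' + \<tau> \<le> 0" using c(1) by (simp add: zero_le_mult_iff)
    then have "\<tau>' + \<tau> = 0" using p(2) q(2) by simp
    then have "x = p" using x_eq by (simp flip: zero_prod_def)
    then show "x \<in> Q" using p by simp
  qed
  moreover have "upper_part T \<inter> {x. a \<bullet> x < 0} = {}"
  proof -
    have "0 \<le> a \<bullet> x" if x: "x \<in> upper_part T" for x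
    proof -
      obtain c where c: "snd c > 0" "x \<in> T" "\<And>y. y \<in> T \<Longrightarrow> c \<bullet> y \<le> c \<bullet> x"
        using x unfolding upper_part_def maximizers_def by blast
      then obtain q \<tau> where q: "q \<in> K" "x = q + (0, \<tau>)" by (auto simp: T_def)
      \<comment> \<open>Comparison with the point at full height \<sigma> above \<open>q\<close>
        forces \<open>x\<close> to be at least \<open>B\<close> above \<open>q\<close>.\<close>
      have "c \<bullet> (q + (0, \<sigma>)) \<le> c \<bullet> x" using c(3) memT[OF q(1)] B(3) by blast
      then have "\<sigma> \<le> \<tau>" using c(1) by (simp add: q(2) inner_up)
      then show ?thesis using B(1)[OF q(1)] B(2) by (simp add: a q(2))
    qed
    then show ?thesis by force
  qed
  ultimately show ?thesis
    unfolding upper_truncation_def T_def[symmetric] using Q_eq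
    by (intro exI[of _ a]) (auto simp: a)
qed

theorem theorem2p1:
  fixes lam :: "'d::{finite,linorder} \<Rightarrow> nat" and n :: nat
  assumes "n > 0"
    and "composition_of n lam"
  shows "\<forall>\<^sub>F s in at_top. \<exists>v.
           upper_truncation (monotone_path_polytope lam)
             ((+) v ` (*\<^sub>R) (1 / real n) ` zonotope_Z lam s)
             {x. (\<Sum>i\<in>UNIV. real (lam i) * fst x $ i) = snd x}"
proof -
  have lam: "\<forall>i. 0 < lam i" and n: "n = card (cells lam)"
    using assms(2) by (auto simp: composition_of_def card_cells)
  have N: "0 < card (cells lam)" using assms(1) n by simp
  have "bounded_linear (\<lambda>q. linear_lift lam (fst q) - snd q)"
    by (intro bounded_linear_sub bounded_linear_compose[OF bounded_linear_linear_lift]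
        bounded_linear_fst bounded_linear_snd)
  then have "bounded ((\<lambda>q. linear_lift lam (fst q) - snd q) ` base_zonotope lam)"
    using compact_imp_bounded[OF compact_base_zonotope] by (rule bounded_linear_image[rotated])
  then obtain B where "\<forall>q\<in>base_zonotope lam. \<bar>linear_lift lam (fst q) - snd q\<bar> \<le> B"
    unfolding bounded_iff by auto
  then have B: "\<And>q. q \<in> base_zonotope lam \<Longrightarrow> linear_lift lam (fst q) - snd q \<le> B"
    by (meson abs_le_D1)
  show ?thesis
  \<comment> \<open>The threshold makes the thickness \<open>s / n\<close> at least
    \<open>B\<close>, and the 0 makes it nonnegative.\<close>
  proof (rule eventually_mono[OF eventually_ge_at_top[of "max 0 (B * real n)"]])
    fix s :: real assume s: "max 0 (B * real n) \<le> s"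
    have "upper_truncation (monotone_path_polytope lam)
        {q + (0, \<tau>) |q \<tau>. q \<in> base_zonotope lam \<and> 0 \<le> \<tau> \<and> \<tau> \<le> s / real n}
        {x. linear_lift lam (fst x) = snd x}"
    proof (rule upper_truncation_thickening)
      show "B \<le> s / real n" "0 \<le> s / real n"
        using s assms(1) by (auto simp: pos_le_divide_eq)
    qed (use B monotone_path_polytope_below monotone_path_polytope_raise[OF lam]
        polytope_above_base_zonotope[OF N] base_zonotope_above_polytope[OF N] in \<open>auto\<close>)
    then show "\<exists>v. upper_truncation (monotone_path_polytope lam)
        ((+) v ` (*\<^sub>R) (1 / real n) ` zonotope_Z lam s)
        {x. (\<Sum>i\<in>UNIV. real (lam i) * fst x $ i) = snd x}"
      using s scaled_zonotope_eq[of s lam] unfolding n linear_lift_def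
      by (intro exI[of _ "(1 / real (card (cells lam))) *\<^sub>R base_point lam"]) simp
  qed
qed

end
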